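(* Let $n\ge 1$ and let $U_1,U_2\in\mathbb{C}_{n\times n}$ be unitary matrices. Then there exist unitary matrices $A_1,A_2\in\mathbb{C}_{n\times n}$ with $[A_1,A_2]=0$ such that $$\|U_1-A_1\|_{tr}\le 30\left(\|[U_1,U_2]\|_{tr}\right)^{1/9}\quad\text{and}\quad \|U_2-A_2\|_{tr}\le 30\left(\|[U_1,U_2]\|_{tr}\right)^{1/9}.$$ In addition, $A_1$ can be chosen so that also $[A_1,U_1]=0$ (i.e. a single pair $A_1,A_2$ satisfies all of these properties).
   Context: $\mathbb{C}_{n\times n}$ is the set of complex $n\times n$ matrices, $[X,Y]=XY-YX$, and $\|A\|_{tr}=\sqrt{\frac1n\sum_{j,k=1}^n|A_{j,k}|^2}$ is the normalized Hilbert-Schmidt norm on $\mathbb{C}_{n\times n}$. *)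

theory Defs
  imports "HOL-Analysis.Analysis"
begin

definition conj_transpose :: "complex^'n^'m \<Rightarrow> complex^'m^'n" where
  "conj_transpose A = (\<chi> i j. cnj (A $ j $ i))"

definition unitary_matrix :: "complex^'n^'n \<Rightarrow> bool" where
  "unitary_matrix U \<longleftrightarrow> conj_transpose U ** U = mat 1 \<and> U ** conj_transpose U = mat 1"

definition commutator :: "complex^'n^'n \<Rightarrow> complex^'n^'n \<Rightarrow> complex^'n^'n" where
  "commutator X Y = X ** Y - Y ** X"

definition norm_tr :: "complex^'n^'n \<Rightarrow> real" where
  "norm_tr A = sqrt (1 / real CARD('n) * (\<Sum>j\<in>UNIV. \<Sum>k\<in>UNIV. (cmod (A $ j $ k))\<^sup>2))"

end

theory Submission
  imports Defs "HOL-Computational_Algebra.Fundamental_Theorem_Algebra"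
begin

text \<open>
  In an eigenbasis of \<open>U\<^sub>1\<close>, with eigenvalues \<open>\<mu>\<^sub>i\<close>, the squared Frobenius norm of the
  commutator is the sum of \<open>|\<mu>\<^sub>i - \<mu>\<^sub>j|\<^sup>2 |u\<^sub>i\<^sub>j|\<^sup>2\<close>, where \<open>u\<close> represents \<open>U\<^sub>2\<close>. Cut the plane
  into squares of side \<open>L\<close>. Averaging over shifts of the grid, the entries \<open>u\<^sub>i\<^sub>j\<close> with \<open>\<mu>\<^sub>i\<close> and \<open>\<mu>\<^sub>j\<close>
  in different squares carry a proportion \<open>O(\<epsilon>/L)\<close> of the mass of \<open>u\<close>, where \<open>\<epsilon>\<close> is the
  normalized norm of the commutator. Let \<open>A\<^sub>1\<close> be \<open>U\<^sub>1\<close> with the eigenvalues in each square replaced by a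
  single one of them, and \<open>A\<^sub>2\<close> the unitary polar factor of the part \<open>X\<close> of \<open>u\<close> that is block diagonal
  with respect to the squares (slightly perturbed to be invertible). If \<open>v\<close> runs through an orthonormal
  eigenbasis of \<open>X\<^sup>* X\<close>, then \<open>A\<^sub>2\<close> and \<open>X\<close> differ on \<open>v\<close> by
  \<open>| \<parallel>X v\<parallel> - 1 | = | \<parallel>X v\<parallel> - \<parallel>u v\<parallel> | \<le> \<parallel>(X - u) v\<parallel>\<close>, so \<open>A\<^sub>2\<close> is at most twice as far from \<open>u\<close> as \<open>X\<close>.
  The choice \<open>L = \<epsilon>\<^bsup>1/3\<^esup>\<close> gives a bound of order \<open>\<epsilon>\<^bsup>1/3\<^esup>\<close>, which suffices because \<open>\<epsilon> \<le> 2\<close>.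
\<close>

section \<open>Conjugate transposes, diagonal matrices and the Frobenius norm\<close>

lemma conj_transpose_nth [simp]: "conj_transpose A $ i $ j = cnj (A $ j $ i)"
  by (simp add: conj_transpose_def)

lemma conj_transpose_conj_transpose [simp]: "conj_transpose (conj_transpose A) = A"
  by (simp add: vec_eq_iff)

lemma conj_transpose_mult: "conj_transpose (A ** B) = conj_transpose B ** conj_transpose A"
  by (simp add: vec_eq_iff matrix_matrix_mult_def mult.commute)

lemma conj_transpose_mat_1 [simp]: "conj_transpose (mat 1) = mat 1"
  by (simp add: vec_eq_iff mat_def)

lemma unitary_matrixI: "conj_transpose U ** U = mat 1 \<Longrightarrow> unitary_matrix U"
  by (simp add: unitary_matrix_def matrix_left_right_inverse)

lemma unitary_matrixD:
  assumes "unitary_matrix U"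
  shows "conj_transpose U ** U = mat 1" "U ** conj_transpose U = mat 1"
  using assms by (auto simp: unitary_matrix_def)

lemma unitary_matrix_conj_transpose: "unitary_matrix U \<Longrightarrow> unitary_matrix (conj_transpose U)"
  by (simp add: unitary_matrix_def)

lemma unitary_matrix_mult:
  assumes "unitary_matrix U" "unitary_matrix V"
  shows "unitary_matrix (U ** V)"
proof (rule unitary_matrixI)
  have "conj_transpose (U ** V) ** (U ** V)
      = conj_transpose V ** (conj_transpose U ** U) ** V"
    by (simp add: conj_transpose_mult matrix_mul_assoc)
  then show "conj_transpose (U ** V) ** (U ** V) = mat 1"
    using assms by (simp add: unitary_matrixD)
qed

lemma unitary_conj_cancel:
  fixes V A B :: "complex^'n^'n"
  assumes "unitary_matrix V"
  shows "V ** (conj_transpose V ** A ** V) ** conj_transpose V = A"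
    and "conj_transpose V ** (V ** A ** conj_transpose V) ** V = A"
    and "(V ** A ** conj_transpose V) ** (V ** B ** conj_transpose V) = V ** (A ** B) ** conj_transpose V"
proof -
  note V = unitary_matrixD[OF assms]
  show "V ** (conj_transpose V ** A ** V) ** conj_transpose V = A"
    by (metis V(2) matrix_mul_assoc matrix_mul_lid matrix_mul_rid)
  show "conj_transpose V ** (V ** A ** conj_transpose V) ** V = A"
    by (metis V(1) matrix_mul_assoc matrix_mul_lid matrix_mul_rid)
  show "(V ** A ** conj_transpose V) ** (V ** B ** conj_transpose V) = V ** (A ** B) ** conj_transpose V"
    by (metis V(1) matrix_mul_assoc matrix_mul_rid)
qed

lemma matrix_mult_diff_left: "(A - B) ** C = A ** C - B ** (C :: complex^'n^'m)"
  by (simp add: vec_eq_iff matrix_matrix_mult_def algebra_simps sum_subtractf)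

lemma matrix_mult_diff_right: "A ** (B - C) = A ** B - A ** (C :: complex^'n^'m)"
  by (simp add: vec_eq_iff matrix_matrix_mult_def algebra_simps sum_subtractf)

section \<open>Multiplication by diagonal matrices\<close>

definition cdiag :: "('n \<Rightarrow> complex) \<Rightarrow> complex^'n^'n" where
  "cdiag d = (\<chi> i j. if i = j then d i else 0)"

lemma cdiag_mult_nth [simp]: "(cdiag d ** A) $ i $ j = d i * A $ i $ j"
  by (simp add: cdiag_def matrix_matrix_mult_def if_distrib[of "\<lambda>x. x * _"] sum.delta cong: if_cong)

lemma mult_cdiag_nth [simp]: "(A ** cdiag d) $ i $ j = A $ i $ j * d j"
  by (simp add: cdiag_def matrix_matrix_mult_def if_distrib[of "\<lambda>x. _ * x"] sum.delta' cong: if_cong)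

lemma unitary_matrix_cdiag_iff: "unitary_matrix (cdiag d) \<longleftrightarrow> (\<forall>i. cmod (d i) = 1)"
proof -
  have "conj_transpose (cdiag d) = cdiag (\<lambda>i. cnj (d i))"
    by (auto simp: vec_eq_iff cdiag_def)
  moreover have "cdiag (\<lambda>i. cnj (d i)) ** cdiag d = mat 1 \<longleftrightarrow> (\<forall>i. cnj (d i) * d i = 1)"
    by (auto simp: vec_eq_iff mat_def) (auto simp: cdiag_def)
  moreover have "cnj z * z = 1 \<longleftrightarrow> cmod z = 1" for z
    using complex_norm_square[of z]
    by (metis mult.commute norm_ge_zero of_real_1 of_real_eq_iff of_real_power power2_eq_1_iff
        power_one real_sqrt_abs real_sqrt_unique zero_le_one abs_of_nonneg)
  ultimately show ?thesis
    by (metis unitary_matrixI unitary_matrixD(1))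
qed

section \<open>The Frobenius norm and its unitary invariance\<close>

lemma norm_matrix_power2: "(norm (A :: complex^'n^'m))\<^sup>2 = (\<Sum>i\<in>UNIV. \<Sum>j\<in>UNIV. (cmod (A $ i $ j))\<^sup>2)"
  by (simp add: norm_vec_def L2_set_def sum_nonneg)

lemma norm_matrix_power2_columns: "(norm (A :: complex^'n^'m))\<^sup>2 = (\<Sum>j\<in>UNIV. (norm (column j A))\<^sup>2)"
  by (subst norm_matrix_power2, subst sum.swap) (simp add: norm_vec_def L2_set_def sum_nonneg column_def)

lemma norm_tr_eq: "norm_tr (A :: complex^'n^'n) = norm A / sqrt CARD('n)"
  by (simp add: norm_tr_def norm_matrix_power2[symmetric] real_sqrt_divide)

lemma norm_conj_transpose [simp]: "norm (conj_transpose A) = norm A"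
proof -
  have "(norm (conj_transpose A))\<^sup>2 = (norm A)\<^sup>2"
    unfolding norm_matrix_power2 by (subst sum.swap) simp
  then show ?thesis by simp
qed

lemma of_real_norm_matrix_power2:
  "complex_of_real ((norm (A :: complex^'n^'n))\<^sup>2) = trace (A ** conj_transpose A)"
  by (simp add: norm_matrix_power2 trace_def matrix_matrix_mult_def complex_norm_square
      del: of_real_power) 

text \<open>The squared norm of \<open>A\<close> is the trace of
  \<open>A ** conj_transpose A\<close>, in which a unitary right factor cancels. The left factor
  reduces to this case by taking conjugate transposes.\<close>

lemma norm_mult_unitary:
  assumes "unitary_matrix U"
  shows "norm (A ** U) = norm A" "norm (U ** A) = norm A"
proof -
  have *: "norm (A ** U) = norm A" if "unitary_matrix U" for A U :: "complex^'a^'a"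
  proof -
    have "(A ** U) ** conj_transpose (A ** U) = A ** (U ** conj_transpose U) ** conj_transpose A"
      by (simp add: conj_transpose_mult matrix_mul_assoc)
    also have "\<dots> = A ** conj_transpose A"
      using that by (simp add: unitary_matrixD)
    finally have "complex_of_real ((norm (A ** U))\<^sup>2) = complex_of_real ((norm A)\<^sup>2)"
      unfolding of_real_norm_matrix_power2 by simp
    then show ?thesis by (simp del: of_real_power)
  qed
  show "norm (A ** U) = norm A" using * assms by blast
  have "norm (U ** A) = norm (conj_transpose A ** conj_transpose U)"
    by (metis conj_transpose_mult norm_conj_transpose)
  then show "norm (U ** A) = norm A"
    using *[OF unitary_matrix_conj_transpose[OF assms]] by simp
qed

lemma norm_unitary_power2:
  fixes U :: "complex^'n^'n"
  assumes "unitary_matrix U"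
  shows "(norm U)\<^sup>2 = CARD('n)"
proof -
  have "complex_of_real ((norm U)\<^sup>2) = of_real CARD('n)"
    unfolding of_real_norm_matrix_power2 by (simp add: unitary_matrixD assms trace_def mat_def)
  then show ?thesis by (simp only: of_real_eq_iff)
qed

lemma norm_column_unitary:
  fixes U :: "complex^'n^'n"
  assumes "unitary_matrix U"
  shows "norm (column k U) = 1"
proof -
  have "(conj_transpose U ** U) $ k $ k = 1"
    using assms by (simp add: unitary_matrixD mat_def)
  then have "complex_of_real ((norm (column k U))\<^sup>2) = of_real 1"
    by (simp add: norm_vec_def L2_set_def sum_nonneg column_def matrix_matrix_mult_def
        complex_norm_square mult.commute del: of_real_power)
  then show ?thesis
    by (simp only: of_real_eq_iff) (simp add: power2_eq_1_iff, use norm_ge_zero[of "column k U"] in linarith)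
qed

section \<open>The spectral theorem for normal matrices\<close>

definition cinner :: "complex^'n \<Rightarrow> complex^'n \<Rightarrow> complex" where
  "cinner x y = (\<Sum>i\<in>UNIV. cnj (x $ i) * y $ i)"

lemma cinner_self: "cinner x x = complex_of_real ((norm x)\<^sup>2)"
  by (simp add: cinner_def norm_vec_def L2_set_def sum_nonneg complex_norm_square mult.commute
      del: of_real_power)

lemma cinner_commute: "cinner x y = cnj (cinner y x)"
  by (simp add: cinner_def mult.commute)

lemma cinner_add_right: "cinner x (y + z) = cinner x y + cinner x z"
  by (simp add: cinner_def algebra_simps sum.distrib)

lemma cinner_scale_right: "cinner x (c *s y) = c * cinner x y"
  by (simp add: cinner_def sum_distrib_left mult.left_commute)

lemma cinner_scale_left: "cinner (c *s x) y = cnj c * cinner x y"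
  by (simp add: cinner_def sum_distrib_left mult.assoc)

lemma cinner_matrix: "cinner x (M *v y) = cinner (conj_transpose M *v x) y"
proof -
  have "cinner x (M *v y) = (\<Sum>i\<in>UNIV. \<Sum>j\<in>UNIV. cnj (x $ i) * (M $ i $ j * y $ j))"
    by (simp add: cinner_def matrix_vector_mult_def sum_distrib_left)
  also have "\<dots> = (\<Sum>j\<in>UNIV. \<Sum>i\<in>UNIV. cnj (x $ i) * (M $ i $ j * y $ j))"
    by (rule sum.swap)
  also have "\<dots> = cinner (conj_transpose M *v x) y"
    by (simp add: cinner_def matrix_vector_mult_def sum_distrib_left sum_distrib_right algebra_simps)
  finally show ?thesis .
qed

lemma cinner_eq_conj_transpose_mult_nth:
  "(conj_transpose A ** B) $ i $ j = cinner (column i A) (column j B)"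
  by (simp add: cinner_def matrix_matrix_mult_def column_def)

text \<open>This is p(M) x, evaluated by Horner's scheme directly on the vector, so that powers of
  matrices never have to be formed.\<close>

definition poly_orbit :: "complex^'n^'n \<Rightarrow> complex^'n \<Rightarrow> complex poly \<Rightarrow> complex^'n" where
  "poly_orbit M x p = fold_coeffs (\<lambda>a v. a *s x + M *v v) p 0"

lemma poly_orbit_0 [simp]: "poly_orbit M x 0 = 0"
  by (simp add: poly_orbit_def)

lemma poly_orbit_pCons [simp]: "poly_orbit M x (pCons a p) = a *s x + M *v poly_orbit M x p"
  by (cases "p = 0"; cases "a = 0") (simp_all add: poly_orbit_def)

lemma poly_orbit_add: "poly_orbit M x (p + q) = poly_orbit M x p + poly_orbit M x q"
  by (induction p q rule: poly_induct2) (simp_all add: matrix_vector_right_distrib vec.scale_left_distrib)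

lemma poly_orbit_smult: "poly_orbit M x (smult c p) = c *s poly_orbit M x p"
  by (induction p) (simp_all add: vec.scale_right_distrib vector_scalar_commute)

lemma poly_orbit_sum: "poly_orbit M x (\<Sum>i\<in>I. f i) = (\<Sum>i\<in>I. poly_orbit M x (f i))"
  by (induction I rule: infinite_finite_induct) (simp_all add: poly_orbit_add)

lemma poly_orbit_monom: "poly_orbit M x (monom c k) = c *s (((*v) M ^^ k) x)"
  by (induction k) (simp_all add: monom_0 monom_Suc vector_scalar_commute)

text \<open>There are more Krylov vectors x, M x, M^2 x, ... than the dimension allows to be
  independent; a linear relation between them is the polynomial.\<close>

lemma exists_annihilating_poly:
  fixes M :: "complex^'n^'n"
  shows "\<exists>p. p \<noteq> 0 \<and> poly_orbit M x p = 0"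
proof -
  define f where "f k = ((*v) M ^^ k) x" for k
  \<comment> \<open>This is the real dimension, because \<open>dependent\<close> refers to real
    scalars; the relation found has real coefficients.\<close>
  define N where "N = DIM(complex^'n)"
  show ?thesis
  \<comment> \<open>Dependence concerns a set of vectors, which loses repetitions. A repetition is
    itself a relation, with polynomial X^i - X^j.\<close>
  proof (cases "inj_on f {..N}")
    case False
    then obtain i j where ij: "i \<noteq> j" "f i = f j" by (auto simp: inj_on_def)
    have "poly_orbit M x (monom 1 i + monom (-1) j) = 0"
      using ij by (simp add: poly_orbit_add poly_orbit_monom f_def)
    moreover have "coeff (monom 1 i + monom (-1) j) i \<noteq> (0::complex)"
      using ij by simp
    ultimately show ?thesis by (metis coeff_0)
  next
    case True
    then have "card (f ` {..N}) > DIM(complex^'n)"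
      by (simp add: card_image N_def)
    then have "dependent (f ` {..N})"
      by (intro dependent_biggerset) auto
    then obtain r v where r: "v \<in> f ` {..N}" "r v \<noteq> 0" "(\<Sum>v\<in>f ` {..N}. r v *\<^sub>R v) = 0"
      by (subst (asm) dependent_finite) auto
    from r(1) obtain k where k: "k \<le> N" "v = f k" by auto
    define p where "p = (\<Sum>i\<le>N. monom (complex_of_real (r (f i))) i)"
    have "poly_orbit M x p = (\<Sum>i\<le>N. r (f i) *\<^sub>R f i)"
      unfolding p_def poly_orbit_sum poly_orbit_monom f_def
      by (intro sum.cong refl) (simp add: vec_eq_iff scaleR_conv_of_real[where 'a = complex])
    also have "\<dots> = 0"
      using r(3) by (simp add: sum.reindex[OF True])
    finally have "poly_orbit M x p = 0" .
    moreover have "coeff p k = r v"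
      using k by (simp add: p_def coeff_sum)
    ultimately show ?thesis using r(2) by (metis coeff_0 of_real_eq_0_iff)
  qed
qed

text \<open>Take an annihilating polynomial p of \<open>x\<close> of least degree and a root z of
  it, so p = (X - z) q. By minimality q(M) x is nonzero, and M - z sends it to p(M) x = 0. It lies
  in \<open>S\<close> because it is built from \<open>x\<close> by the operations under which
  \<open>S\<close> is closed.\<close>

lemma eigenvector_in_invariant_subspace:
  fixes M :: "complex^'n^'n"
  assumes "x \<in> S" "x \<noteq> 0" "0 \<in> S"
    and add: "\<And>y z. y \<in> S \<Longrightarrow> z \<in> S \<Longrightarrow> y + z \<in> S"
    and scale: "\<And>c y. y \<in> S \<Longrightarrow> c *s y \<in> S"
    and inv: "\<And>y. y \<in> S \<Longrightarrow> M *v y \<in> S"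
  shows "\<exists>v \<mu>. v \<in> S \<and> v \<noteq> 0 \<and> M *v v = \<mu> *s v"
proof -
  obtain p\<^sub>0 where "p\<^sub>0 \<noteq> 0 \<and> poly_orbit M x p\<^sub>0 = 0"
    using exists_annihilating_poly by blast
  then have "\<exists>p. (p \<noteq> 0 \<and> poly_orbit M x p = 0) \<and>
      (\<forall>q. q \<noteq> 0 \<and> poly_orbit M x q = 0 \<longrightarrow> degree p \<le> degree q)"
    by (rule ex_has_least_nat)
  then obtain p where p: "p \<noteq> 0" "poly_orbit M x p = 0"
    and min: "\<And>q. q \<noteq> 0 \<Longrightarrow> poly_orbit M x q = 0 \<Longrightarrow> degree p \<le> degree q"
    by blast
  have "degree p \<noteq> 0"
  proof
    assume "degree p = 0"
    then obtain c where c: "p = [:c:]" by (metis degree_eq_zeroE)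
    then show False using p assms(2) by simp
  qed
  then have "\<not> constant (poly p)" by (simp add: constant_degree)
  then obtain z where "poly p z = 0" using fundamental_theorem_of_algebra by blast
  then obtain q where q: "p = [:-z, 1:] * q" by (auto simp: poly_eq_0_iff_dvd)
  then have "q \<noteq> 0" using p by auto
  moreover have "degree p = Suc (degree q)" unfolding q using \<open>q \<noteq> 0\<close> by (subst degree_mult_eq) auto
  ultimately have "poly_orbit M x q \<noteq> 0" using min[of q] by force
  moreover have "M *v poly_orbit M x q = z *s poly_orbit M x q"
  proof -
    \<comment> \<open>The product (X - z) q is split into a scalar multiple and a shift, the two
      operations that \<open>poly_orbit\<close> turns into scaling and applying
      \<open>M\<close>.\<close>
    have "p = smult (- z) q + pCons 0 q" by (simp add: q)
    then have "- z *s poly_orbit M x q + M *v poly_orbit M x q = 0"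
      using p(2) by (simp only: poly_orbit_add poly_orbit_smult) simp
    then show ?thesis by (simp add: eq_neg_iff_add_eq_0 add.commute)
  qed
  moreover have "poly_orbit M x q \<in> S"
    by (induction q) (auto intro: assms)
  ultimately show ?thesis by blast
qed

text \<open>Orthogonality to the \<open>w i\<close> with \<open>i\<close> in \<open>J\<close> is a
  square linear system whose row \<open>k\<close> is zero, hence singular.\<close>

lemma exists_orthogonal_vector:
  fixes w :: "'n \<Rightarrow> complex^'n"
  assumes "k \<notin> J"
  shows "\<exists>x. x \<noteq> 0 \<and> (\<forall>i\<in>J. cinner (w i) x = 0)"
proof -
  define A :: "complex^'n^'n" where "A = (\<chi> i. if i \<in> J then (\<chi> j. cnj (w i $ j)) else 0)"
  have "row k A = 0" using assms by (simp add: row_def A_def vec_eq_iff)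
  then have "det A = 0" by (rule det_zero_row)
  then have "\<not> invertible A" by (simp add: invertible_det_nz)
  then obtain x where x: "A *v x = 0" "x \<noteq> 0"
    by (metis invertible_left_inverse matrix_left_invertible_ker)
  have "cinner (w i) x = 0" if "i \<in> J" for i
  proof -
    have "(A *v x) $ i = cinner (w i) x"
      using that by (simp add: A_def matrix_vector_mult_def cinner_def)
    then show ?thesis using x by simp
  qed
  then show ?thesis using x by blast
qed

text \<open>N = M - \<mu> is again normal, and for normal N the vectors N v and N^* v have equal
  norm; here N v = 0.\<close>

lemma normal_eigenvector_conj_transpose:
  fixes M :: "complex^'n^'n"
  assumes "M ** conj_transpose M = conj_transpose M ** M" "M *v v = \<mu> *s v"
  shows "conj_transpose M *v v = cnj \<mu> *s v"
proof -
  define N where "N = M - mat \<mu>"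
  have ct: "conj_transpose N = conj_transpose M - mat (cnj \<mu>)"
    by (auto simp: vec_eq_iff N_def mat_def)
  have mats: "A ** mat c = mat c ** A" for A :: "complex^'n^'n" and c
    by (simp add: vec_eq_iff matrix_matrix_mult_def mat_def if_distrib[of "\<lambda>x. x * _"]
        if_distrib[of "\<lambda>x. _ * x"] sum.delta sum.delta' mult.commute cong: if_cong)
  have normal: "N ** conj_transpose N = conj_transpose N ** N"
    unfolding ct unfolding N_def
    by (simp add: matrix_mult_diff_left matrix_mult_diff_right assms(1)
        mats[of M "cnj \<mu>"] mats[of "conj_transpose M" \<mu>] mats[of "mat \<mu>" "cnj \<mu>"])
  have mat_v: "mat c *v v = c *s v" for c
    by (simp add: vec_eq_iff matrix_vector_mult_def mat_def if_distrib[of "\<lambda>x. x * _"] sum.delta cong: if_cong)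
  have "N *v v = 0"
    by (simp add: N_def matrix_vector_mult_diff_rdistrib assms(2) mat_v)
  have "cinner (conj_transpose N *v v) (conj_transpose N *v v) = cinner v (N *v (conj_transpose N *v v))"
    by (simp add: cinner_matrix)
  also have "\<dots> = cinner v (conj_transpose N *v (N *v v))"
    by (simp add: matrix_vector_mul_assoc normal)
  also have "\<dots> = 0" by (simp add: \<open>N *v v = 0\<close> cinner_def)
  finally have "conj_transpose N *v v = 0" by (simp add: cinner_self)
  then show ?thesis
    by (simp add: ct matrix_vector_mult_diff_rdistrib mat_v)
qed

text \<open>Eigenvectors are added one at a time. Those already found are also eigenvectors of the
  adjoint, so their orthogonal complement is invariant under \<open>M\<close> and contains a further
  one. Indexing by subsets of the matrix index type lets the complete family serve as the columns of
  a matrix.\<close>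

lemma normal_orthonormal_eigenvectors:
  fixes M :: "complex^'n^'n"
  assumes normal: "M ** conj_transpose M = conj_transpose M ** M"
  shows "\<exists>(w :: 'n \<Rightarrow> complex^'n) d. \<forall>i\<in>J. M *v w i = d i *s w i \<and>
      (\<forall>j\<in>J. cinner (w i) (w j) = (if i = j then 1 else 0))"
proof -
  have "finite J" by simp
  then show ?thesis
  proof (induction J rule: finite_induct)
    case empty
    then show ?case by simp
  next
    case (insert k J)
    then obtain w :: "'n \<Rightarrow> complex^'n" and d where
      eig: "\<And>i. i \<in> J \<Longrightarrow> M *v w i = d i *s w i" and
      orth: "\<And>i j. i \<in> J \<Longrightarrow> j \<in> J \<Longrightarrow> cinner (w i) (w j) = (if i = j then 1 else 0)"
      by blast
    define S where "S = {x. \<forall>i\<in>J. cinner (w i) x = 0}"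
    obtain x where x: "x \<noteq> 0" "x \<in> S"
      using exists_orthogonal_vector[OF \<open>k \<notin> J\<close>] by (auto simp: S_def)
    have inv: "M *v y \<in> S" if "y \<in> S" for y
      using that by (auto simp: S_def cinner_matrix normal_eigenvector_conj_transpose[OF normal eig]
          cinner_scale_left)
    have "\<exists>v \<mu>. v \<in> S \<and> v \<noteq> 0 \<and> M *v v = \<mu> *s v"
      by (rule eigenvector_in_invariant_subspace[OF x(2,1)])
        (use inv in \<open>auto simp: S_def cinner_add_right cinner_scale_right cinner_def[of _ 0]\<close>)
    then obtain v \<mu> where v: "v \<in> S" "v \<noteq> 0" "M *v v = \<mu> *s v" by blast
    define v' where "v' = complex_of_real (1 / norm v) *s v"
    have unit: "cinner v' v' = 1"
      using v(2) by (simp add: v'_def cinner_scale_left cinner_scale_right cinner_self[of v] power2_eq_square)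
    have perp: "cinner (w i) v' = 0" "cinner v' (w i) = 0" if "i \<in> J" for i
    proof -
      show "cinner (w i) v' = 0" using that v(1) by (simp add: v'_def cinner_scale_right S_def)
      then show "cinner v' (w i) = 0" by (subst cinner_commute) simp
    qed
    have "M *v v' = \<mu> *s v'"
      by (simp add: v'_def vector_scalar_commute v(3) vec.scale_left_commute)
    then have "\<forall>i\<in>insert k J. M *v (w(k := v')) i = (d(k := \<mu>)) i *s (w(k := v')) i \<and>
      (\<forall>j\<in>insert k J. cinner ((w(k := v')) i) ((w(k := v')) j) = (if i = j then 1 else 0))"
      using \<open>k \<notin> J\<close> eig orth perp unit by auto
    then show ?case by blast
  qed
qed

lemma normal_unitarily_diagonalizable:
  fixes M :: "complex^'n^'n"
  assumes "M ** conj_transpose M = conj_transpose M ** M"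
  obtains V d where "unitary_matrix V" "conj_transpose V ** M ** V = cdiag d"
proof -
  obtain w :: "'n \<Rightarrow> complex^'n" and d where
    eig: "\<And>i. M *v w i = d i *s w i" and
    orth: "\<And>i j. cinner (w i) (w j) = (if i = j then 1 else 0)"
    using normal_orthonormal_eigenvectors[OF assms, of UNIV] by (auto simp del: split_paired_Ex)
  define V where "V = (\<chi> i j. w j $ i)"
  have col: "column j V = w j" for j by (simp add: column_def V_def vec_eq_iff)
  have V: "conj_transpose V ** V = mat 1"
    by (simp add: vec_eq_iff cinner_eq_conj_transpose_mult_nth col orth mat_def)
  have "column j (M ** V) = M *v column j V" for j
    by (simp add: vec_eq_iff column_def matrix_matrix_mult_def matrix_vector_mult_def)
  then have "column j (M ** V) = column j (V ** cdiag d)" for j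
    by (simp add: col eig) (simp add: column_def vec_eq_iff V_def mult.commute)
  then have "M ** V = V ** cdiag d" by (simp add: column_def vec_eq_iff)
  then have "conj_transpose V ** M ** V = cdiag d"
    by (metis V matrix_mul_assoc matrix_mul_lid)
  then show ?thesis using that V unitary_matrixI by blast
qed


section \<open>Polar decomposition\<close>

text \<open>Commuting with \<open>cdiag d\<close> forces \<open>C $ i $ j\<close> to vanish whenever
  \<open>d i\<close> and \<open>d j\<close> differ. This is functional calculus for diagonal
  matrices: \<open>cdiag f\<close> is a function of \<open>cdiag d\<close>.\<close>

lemma commutes_with_cdiag_function:
  assumes "C ** cdiag d = cdiag d ** C" "\<And>i j. d i = d j \<Longrightarrow> f i = f j"
  shows "C ** cdiag f = cdiag f ** C"
proof -
  have "C $ i $ j * f j = f i * C $ i $ j" for i j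
  proof (cases "d i = d j")
    case False
    have "(C ** cdiag d) $ i $ j = (cdiag d ** C) $ i $ j" using assms(1) by simp
    then have "C $ i $ j = 0" using False by (simp add: mult.commute)
    then show ?thesis by simp
  qed (use assms(2)[of i j] in simp)
  then show ?thesis by (simp add: vec_eq_iff)
qed

text \<open>The factor is X H^(-1/2) with H = X^* X. In an eigenbasis of H the columns of
  \<open>X\<close> become orthogonal, and normalizing them gives a unitary matrix. What commutes
  with \<open>X\<close> and its adjoint commutes with H, hence with H^(-1/2).\<close>

lemma exists_unitary_polar_factor:
  fixes X :: "complex^'n^'n"
  assumes "det X \<noteq> 0"
  obtains A where "unitary_matrix A"
    "\<And>u. unitary_matrix u \<Longrightarrow> norm (A - X) \<le> norm (X - u)"
    "\<And>C. C ** X = X ** C \<Longrightarrow> C ** conj_transpose X = conj_transpose X ** C \<Longrightarrow> C ** A = A ** C"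
proof -
  define H where "H = conj_transpose X ** X"
  have "conj_transpose H = H" by (simp add: H_def conj_transpose_mult)
  then have "H ** conj_transpose H = conj_transpose H ** H" by simp
  then obtain V d where V: "unitary_matrix V" and d: "conj_transpose V ** H ** V = cdiag d"
    by (rule normal_unitarily_diagonalizable)
  define Y where "Y = X ** V"
  \<comment> \<open>These are the singular values of \<open>X\<close>, and \<open>f\<close> holds
    their inverses.\<close>
  define s where "s k = norm (column k Y)" for k
  define f where "f k = complex_of_real (1 / s k)" for k
  define Z where "Z = Y ** cdiag f"
  define A where "A = Z ** conj_transpose V"
  have YY: "conj_transpose Y ** Y = cdiag d"
    unfolding Y_def d[symmetric] H_def by (simp add: conj_transpose_mult matrix_mul_assoc)
  have "det V \<noteq> 0"
    using unitary_matrixD[OF V] by (metis invertible_def invertible_det_nz)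
  then have "det Y \<noteq> 0" using assms by (simp add: Y_def det_mul)
  then have s_nz: "s k \<noteq> 0" for k
    using det_zero_column[of k Y] by (auto simp: s_def)
  have d_s: "d k = of_real ((s k)\<^sup>2)" for k
  proof -
    have "d k = (conj_transpose Y ** Y) $ k $ k" by (simp add: YY cdiag_def)
    then show ?thesis by (simp add: cinner_eq_conj_transpose_mult_nth cinner_self s_def)
  qed
  have "conj_transpose Z = cdiag f ** conj_transpose Y"
    by (simp add: vec_eq_iff Z_def f_def mult.commute)
  then have "conj_transpose Z ** Z = cdiag f ** (conj_transpose Y ** Y) ** cdiag f"
    by (simp add: Z_def matrix_mul_assoc)
  also have "\<dots> = mat 1"
    unfolding YY using s_nz
    by (auto simp: vec_eq_iff mat_def) (auto simp: cdiag_def d_s f_def power2_eq_square)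
  finally have "unitary_matrix Z" by (rule unitary_matrixI)
  then have A: "unitary_matrix A"
    unfolding A_def by (intro unitary_matrix_mult unitary_matrix_conj_transpose V)
  have "norm (A - X) \<le> norm (X - u)" if u: "unitary_matrix u" for u
  proof -
    have "norm (A - X) = norm ((A - X) ** V)" by (simp add: norm_mult_unitary V)
    also have "(A - X) ** V = Z - Y"
      by (simp add: matrix_mult_diff_left A_def Y_def matrix_mul_assoc[symmetric] unitary_matrixD[OF V])
    finally have AX: "norm (A - X) = norm (Z - Y)" .
    have Xu: "norm (X - u) = norm (Y - u ** V)"
      by (metis Y_def matrix_mult_diff_left norm_mult_unitary(1)[OF V])
    \<comment> \<open>The columns of \<open>u ** V\<close> are unit vectors, and the unit vector
      nearest to a column of \<open>Y\<close> is obtained by rescaling that column.\<close>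
    have "norm (column k (Z - Y)) \<le> norm (column k (Y - u ** V))" for k
    proof -
      have "column k (Z - Y) = (1 / s k - 1) *\<^sub>R column k Y"
        by (simp add: vec_eq_iff column_def Z_def f_def scaleR_conv_of_real[where 'a = complex] algebra_simps)
      then have "norm (column k (Z - Y)) = \<bar>(1 / s k - 1) * s k\<bar>"
        by (simp add: abs_mult s_def)
      also have "\<dots> = \<bar>s k - 1\<bar>" using s_nz[of k] by (simp add: algebra_simps abs_minus_commute)
      also have "\<dots> = \<bar>norm (column k Y) - norm (column k (u ** V))\<bar>"
        using norm_column_unitary[OF unitary_matrix_mult[OF u V]] by (simp add: s_def)
      also have "\<dots> \<le> norm (column k Y - column k (u ** V))" by (rule norm_triangle_ineq3)
      also have "column k Y - column k (u ** V) = column k (Y - u ** V)"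
        by (simp add: vec_eq_iff column_def)
      finally show ?thesis .
    qed
    then have "(norm (Z - Y))\<^sup>2 \<le> (norm (Y - u ** V))\<^sup>2"
      unfolding norm_matrix_power2_columns by (intro sum_mono power_mono) auto
    then show ?thesis unfolding AX Xu by (rule power2_le_imp_le) simp
  qed
  moreover have "C ** A = A ** C"
    if C: "C ** X = X ** C" "C ** conj_transpose X = conj_transpose X ** C" for C
  proof -
    define C' where "C' = conj_transpose V ** C ** V"
    have C': "C = V ** C' ** conj_transpose V"
      unfolding C'_def by (simp add: unitary_conj_cancel V)
    have H: "H = V ** cdiag d ** conj_transpose V"
      unfolding d[symmetric] by (simp add: unitary_conj_cancel V)
    have "C ** H = H ** C" unfolding H_def by (metis C matrix_mul_assoc)
    then have "V ** (C' ** cdiag d) ** conj_transpose V = V ** (cdiag d ** C') ** conj_transpose V"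
      unfolding C' H by (simp only: unitary_conj_cancel[OF V])
    then have "C' ** cdiag d = cdiag d ** C'"
      by (metis unitary_conj_cancel(2)[OF V])
    \<comment> \<open>Since \<open>d k\<close> is the square of the nonnegative number
      \<open>s k\<close>, equal values of \<open>d\<close> give equal values of
      \<open>f\<close>.\<close>
    then have "C' ** cdiag f = cdiag f ** C'"
      by (rule commutes_with_cdiag_function) (simp add: d_s f_def s_def del: of_real_power)
    then have "C ** (V ** cdiag f ** conj_transpose V) = (V ** cdiag f ** conj_transpose V) ** C"
      unfolding C' by (simp only: unitary_conj_cancel[OF V])
    \<comment> \<open>The second factor is H^(-1/2).\<close>
    moreover have "A = X ** (V ** cdiag f ** conj_transpose V)"
      by (simp add: A_def Z_def Y_def matrix_mul_assoc)
    ultimately show ?thesis by (metis C(1) matrix_mul_assoc)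
  qed
  ultimately show ?thesis using that A by blast
qed

text \<open>Along the line from \<open>B\<close> to the identity the determinant is a polynomial in
  \<open>z\<close> with value 1 at z = 1, so it has only finitely many roots.\<close>

lemma exists_small_invertible_perturbation:
  fixes B :: "complex^'n^'n"
  assumes "\<delta> > 0"
  obtains z where "0 < z" "z < \<delta>" "det (B + z *\<^sub>R (mat 1 - B)) \<noteq> 0"
proof -
  define P :: "complex poly^'n^'n" where
    "P = (\<chi> i j. [:B $ i $ j, (mat 1 - B) $ i $ j:])"
  have P: "poly (det P) z = det (\<chi> i j. B $ i $ j + z * (mat 1 - B) $ i $ j)" for z
    by (simp add: det_def poly_sum poly_prod P_def)
  have "(\<chi> i j. B $ i $ j + 1 * (mat 1 - B) $ i $ j) = (mat 1 :: complex^'n^'n)"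
    by (simp add: vec_eq_iff)
  then have "poly (det P) 1 = 1" unfolding P by simp
  then have "det P \<noteq> 0" by force
  then have "finite {z. poly (det P) z = 0}" by (rule poly_roots_finite)
  then have "finite (complex_of_real -` {z. poly (det P) z = 0})"
    by (rule finite_vimageI) (simp add: inj_def)
  moreover have "infinite {0<..<\<delta>}" using assms by simp
  ultimately have "\<not> {0<..<\<delta>} \<subseteq> complex_of_real -` {z. poly (det P) z = 0}"
    using finite_subset by blast
  then obtain z where z: "0 < z" "z < \<delta>" "poly (det P) (of_real z) \<noteq> 0"
    by (auto simp: subset_iff)
  have "(\<chi> i j. B $ i $ j + of_real z * (mat 1 - B) $ i $ j) = B + z *\<^sub>R (mat 1 - B)"
    by (simp add: vec_eq_iff scaleR_conv_of_real[where 'a = complex])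
  then have "det (B + z *\<^sub>R (mat 1 - B)) \<noteq> 0" using z(3) unfolding P by simp
  then show ?thesis using that z(1,2) by blast
qed

text \<open>Interpolating the block part towards the identity makes it invertible without leaving the
  block algebra, so that its polar factor is available.\<close>

lemma exists_unitary_commuting_with_cdiag:
  fixes u :: "complex^'n^'n"
  assumes u: "unitary_matrix u" and "\<delta> > 0"
  obtains A where "unitary_matrix A" "cdiag a ** A = A ** cdiag a"
    "norm (A - u) \<le> 2 * sqrt (\<Sum>i\<in>UNIV. \<Sum>j\<in>UNIV. if a i = a j then 0 else (cmod (u $ i $ j))\<^sup>2) + \<delta>"
proof -
  define B :: "complex^'n^'n" where "B = (\<chi> i j. if a i = a j then u $ i $ j else 0)"
  \<comment> \<open>The factor 2 anticipates the doubling of the distance by the polar factor; the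
    summand 1 keeps \<open>K\<close> positive when \<open>B\<close> is the identity.\<close>
  define K where "K = 2 * norm (mat 1 - B) + 1"
  have K: "K > 0" by (simp add: K_def add_nonneg_pos)
  then obtain z where z: "0 < z" "z < \<delta> / K" "det (B + z *\<^sub>R (mat 1 - B)) \<noteq> 0"
    using exists_small_invertible_perturbation[of "\<delta> / K" B] \<open>\<delta> > 0\<close> by auto
  define X where "X = B + z *\<^sub>R (mat 1 - B)"
  obtain A where A: "unitary_matrix A" "norm (A - X) \<le> norm (X - u)"
    "\<And>C. C ** X = X ** C \<Longrightarrow> C ** conj_transpose X = conj_transpose X ** C \<Longrightarrow> C ** A = A ** C"
    using exists_unitary_polar_factor[of X] z(3) u unfolding X_def by metis
  \<comment> \<open>The zero pattern is symmetric in \<open>i\<close> and \<open>j\<close>, so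
    \<open>cdiag a\<close> commutes with \<open>X\<close> and with its adjoint, and therefore with
    the polar factor.\<close>
  have X0: "X $ i $ j = 0" if "a i \<noteq> a j" for i j
    using that by (auto simp: X_def B_def mat_def)
  have commute: "cdiag a ** A = A ** cdiag a"
  proof (rule A(3))
    have "a i * X $ i $ j = X $ i $ j * a j" for i j
      using X0[of i j] by (cases "a i = a j") auto
    then show "cdiag a ** X = X ** cdiag a" by (simp add: vec_eq_iff)
    have "a i * cnj (X $ j $ i) = cnj (X $ j $ i) * a j" for i j
      using X0[of j i] by (cases "a i = a j") auto
    then show "cdiag a ** conj_transpose X = conj_transpose X ** cdiag a" by (simp add: vec_eq_iff)
  qed
  have "norm (A - u) \<le> norm (A - X) + norm (X - u)"
    using norm_triangle_ineq[of "A - X" "X - u"] by simp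
  also have "\<dots> \<le> 2 * norm (X - u)" using A(2) by simp
  also have "norm (X - u) \<le> norm (B - u) + z * norm (mat 1 - B)"
    using norm_triangle_ineq[of "B - u" "z *\<^sub>R (mat 1 - B)"] z(1)
    by (simp add: X_def add_diff_eq diff_add_eq del: scaleR_diff_right)
  finally have "norm (A - u) \<le> 2 * norm (B - u) + z * (2 * norm (mat 1 - B))" by simp
  also have "z * (2 * norm (mat 1 - B)) \<le> z * K" using z(1) by (simp add: K_def)
  also have "z * K \<le> \<delta>" using z(2) K by (simp add: field_simps)
  also have "norm (B - u) = sqrt (\<Sum>i\<in>UNIV. \<Sum>j\<in>UNIV. if a i = a j then 0 else (cmod (u $ i $ j))\<^sup>2)"
  proof -
    have "(norm (B - u))\<^sup>2 = (\<Sum>i\<in>UNIV. \<Sum>j\<in>UNIV. if a i = a j then 0 else (cmod (u $ i $ j))\<^sup>2)"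
      unfolding norm_matrix_power2 by (intro sum.cong refl) (simp add: B_def)
    then show ?thesis by (metis norm_ge_zero real_sqrt_unique)
  qed
  finally show ?thesis using that A(1) commute by simp
qed

section \<open>Averaging over shifted grids\<close>

text \<open>An integer form of Hermite's identity: replacing p by p + 1 telescopes to a gain of (p +
  M) div M - p div M = 1, and every summand vanishes for p = 0.\<close>

lemma sum_shifted_div:
  fixes p :: int and M :: nat
  assumes "M > 0"
  shows "(\<Sum>k<M. (p + int k) div int M) = p"
proof -
  define S where "S p = (\<Sum>k<M. (p + int k) div int M)" for p
  have step: "S (p + 1) = S p + 1" for p
  proof -
    define g where "g k = (p + int k) div int M" for k
    have "S (p + 1) = (\<Sum>k<M. g (Suc k))"
      by (simp add: S_def g_def algebra_simps)
    also have "\<dots> = S p + (g M - g 0)"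
      using sum_lessThan_telescope[of g M] by (simp add: S_def g_def[symmetric] sum_subtractf)
    also have "g M - g 0 = 1" using assms by (simp add: g_def)
    finally show ?thesis .
  qed
  have "S 0 = 0" unfolding S_def by (intro sum.neutral) auto
  then have "S p = p"
  proof (induction p rule: int_induct[of _ 0])
    case (step2 i)
    then show ?case using step[of "i - 1"] by simp
  qed (simp_all add: step)
  then show ?thesis by (simp add: S_def)
qed

text \<open>For q \<le> p the difference of the quotients is a nonnegative integer, so it dominates
  the indicator of being nonzero; these differences sum to p - q.\<close>

lemma card_shifts_separating:
  fixes p q :: int and M :: nat
  assumes "M > 0"
  shows "(\<Sum>k<M. of_bool ((p + int k) div int M \<noteq> (q + int k) div int M)) \<le> \<bar>p - q\<bar>"
proof -
  have *: "(\<Sum>k<M. of_bool ((p + int k) div int M \<noteq> (q + int k) div int M)) \<le> p - q"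
    if "q \<le> p" for p q :: int
  proof -
    have "(\<Sum>k<M. of_bool ((p + int k) div int M \<noteq> (q + int k) div int M))
        \<le> (\<Sum>k<M. (p + int k) div int M - (q + int k) div int M)"
    proof (rule sum_mono)
      fix k
      have "(q + int k) div int M \<le> (p + int k) div int M"
        using that assms by (intro zdiv_mono1) auto
      then show "of_bool ((p + int k) div int M \<noteq> (q + int k) div int M)
          \<le> (p + int k) div int M - (q + int k) div int M" by (auto simp: of_bool_def)
    qed
    also have "\<dots> = p - q" by (simp add: sum_subtractf sum_shifted_div assms)
    finally show ?thesis .
  qed
  show ?thesis
  proof (cases "q \<le> p")
    case False
    then show ?thesis using *[of p q] by (simp add: eq_commute)
  qed (use * in simp)
qed

text \<open>The average runs over \<open>M\<close> equally spaced diagonal shifts of a grid of side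
  \<open>L\<close>. Each coordinate separates a pair for a proportion at most distance / L + 1 / M
  of the shifts, the last term being the discretization error. Some shift does no worse than the
  average.\<close>

lemma exists_grid_partition:
  fixes \<mu> :: "'n::finite \<Rightarrow> complex" and w :: "'n \<Rightarrow> 'n \<Rightarrow> real" and M :: nat
  assumes "L > 0" "M > 0" and w: "\<And>i j. w i j \<ge> 0"
  obtains c :: "'n \<Rightarrow> int \<times> int" where
    "\<And>i j. c i = c j \<Longrightarrow> cmod (\<mu> i - \<mu> j) \<le> 2 * L"
    "(\<Sum>i\<in>UNIV. \<Sum>j\<in>UNIV. if c i = c j then 0 else w i j)
      \<le> (\<Sum>i\<in>UNIV. \<Sum>j\<in>UNIV. w i j * (2 * cmod (\<mu> i - \<mu> j) / L + 2 / M))"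
proof -
  \<comment> \<open>Positions are counted in units of L / M, so a cell of side \<open>L\<close> is
    \<open>M\<close> units long and one shift moves by one unit.\<close>
  define pos where "pos x = \<lfloor>x * M / L\<rfloor>" for x :: real
  define cell where "cell k x = (pos x + int k) div int M" for k x
  define c where "c k i = (cell k (Re (\<mu> i)), cell k (Im (\<mu> i)))" for k i
  define D where "D i j = 2 * cmod (\<mu> i - \<mu> j) / L + 2 / M" for i j
  define F where "F k = (\<Sum>i\<in>UNIV. \<Sum>j\<in>UNIV. if c k i = c k j then 0 else w i j)" for k
  have less: "x - y < L" if "cell k x = cell k y" for k x y
  proof -
    have "pos x + k = cell k x * M + (pos x + k) mod M" "pos y + k = cell k y * M + (pos y + k) mod M"
      unfolding cell_def by simp_all
    then have "pos x - pos y = (pos x + k) mod M - (pos y + k) mod M"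
      using that by simp
    \<comment> \<open>Remainders differ by at most M - 1; the unit to spare pays for the rounding in
      \<open>pos\<close>.\<close>
    also have "\<dots> \<le> int M - 1"
      using assms(2) pos_mod_bound[of "int M" "pos x + k"] pos_mod_sign[of "int M" "pos y + k"]
      by linarith
    finally have "pos x \<le> pos y + int M - 1" by simp
    then have "x * M / L < y * M / L + M"
      unfolding pos_def by linarith
    also have "\<dots> = (y + L) * M / L" using assms by (simp add: field_simps)
    finally show ?thesis using assms by (simp add: divide_less_cancel)
  qed
  have near: "cmod (\<mu> i - \<mu> j) \<le> 2 * L" if "c k i = c k j" for k i j
  proof -
    have "\<bar>Re (\<mu> i - \<mu> j)\<bar> \<le> L" "\<bar>Im (\<mu> i - \<mu> j)\<bar> \<le> L"
      using that less[of k "Re (\<mu> i)" "Re (\<mu> j)"] less[of k "Re (\<mu> j)" "Re (\<mu> i)"]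
        less[of k "Im (\<mu> i)" "Im (\<mu> j)"] less[of k "Im (\<mu> j)" "Im (\<mu> i)"]
      by (auto simp: c_def)
    then show ?thesis using cmod_le[of "\<mu> i - \<mu> j"] by linarith
  qed
  have separated: "(\<Sum>k<M. of_bool (cell k x \<noteq> cell k y)) \<le> \<bar>x - y\<bar> * M / L + 1" for x y :: real
  proof -
    have "(\<Sum>k<M. of_bool (cell k x \<noteq> cell k y)) = real_of_int (\<Sum>k<M. of_bool (cell k x \<noteq> cell k y))"
      by simp
    also have "\<dots> \<le> real_of_int \<bar>pos x - pos y\<bar>"
      unfolding cell_def of_int_le_iff by (rule card_shifts_separating[OF assms(2)])
    \<comment> \<open>Taking floors can increase the distance by less than one unit.\<close>
    also have "\<dots> \<le> \<bar>x * M / L - y * M / L\<bar> + 1"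
      unfolding pos_def by linarith
    also have "x * M / L - y * M / L = (x - y) * (M / L)" by (simp add: left_diff_distrib diff_divide_distrib)
    also have "\<bar>(x - y) * (M / L)\<bar> = \<bar>x - y\<bar> * M / L" using assms by (simp add: abs_mult)
    finally show ?thesis .
  qed
  have average: "(\<Sum>k<M. of_bool (c k i \<noteq> c k j)) \<le> M * D i j" for i j
  proof -
    have "(\<Sum>k<M. of_bool (c k i \<noteq> c k j)) \<le>
       (\<Sum>k<M. of_bool (cell k (Re (\<mu> i)) \<noteq> cell k (Re (\<mu> j)))
             + (of_bool (cell k (Im (\<mu> i)) \<noteq> cell k (Im (\<mu> j))) :: real))"
      by (intro sum_mono) (auto simp: c_def of_bool_def)
    also have "\<dots> \<le> (\<bar>Re (\<mu> i) - Re (\<mu> j)\<bar> * M / L + 1) + (\<bar>Im (\<mu> i) - Im (\<mu> j)\<bar> * M / L + 1)"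
      unfolding sum.distrib by (intro add_mono separated)
    also have "\<dots> \<le> (cmod (\<mu> i - \<mu> j) * M / L + 1) + (cmod (\<mu> i - \<mu> j) * M / L + 1)"
      using assms abs_Re_le_cmod[of "\<mu> i - \<mu> j"] abs_Im_le_cmod[of "\<mu> i - \<mu> j"]
      by (intro add_mono divide_right_mono mult_right_mono) auto
    also have "\<dots> = M * D i j" using assms by (simp add: D_def field_simps)
    finally show ?thesis .
  qed
  have "(\<Sum>k<M. F k) = (\<Sum>k<M. \<Sum>i\<in>UNIV. \<Sum>j\<in>UNIV. w i j * of_bool (c k i \<noteq> c k j))"
    unfolding F_def by (intro sum.cong refl) auto
  also have "\<dots> = (\<Sum>i\<in>UNIV. \<Sum>k<M. \<Sum>j\<in>UNIV. w i j * of_bool (c k i \<noteq> c k j))"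
    by (rule sum.swap)
  also have "\<dots> = (\<Sum>i\<in>UNIV. \<Sum>j\<in>UNIV. w i j * (\<Sum>k<M. of_bool (c k i \<noteq> c k j)))"
    unfolding sum_distrib_left by (intro sum.cong refl, rule sum.swap)
  also have "\<dots> \<le> (\<Sum>i\<in>UNIV. \<Sum>j\<in>UNIV. w i j * (M * D i j))"
    by (intro sum_mono mult_left_mono average w)
  also have "\<dots> = (\<Sum>k<M. \<Sum>i\<in>UNIV. \<Sum>j\<in>UNIV. w i j * D i j)"
    by (simp add: sum_distrib_left mult.left_commute)
  \<comment> \<open>If every shift exceeded the average, so would the sum, strictly because there is
    at least one shift.\<close>
  finally have "\<not> (\<Sum>k<M. \<Sum>i\<in>UNIV. \<Sum>j\<in>UNIV. w i j * D i j) < (\<Sum>k<M. F k)"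
    by (rule leD)
  then have "\<exists>k<M. \<not> (\<Sum>i\<in>UNIV. \<Sum>j\<in>UNIV. w i j * D i j) < F k"
    by (rule contrapos_np, intro sum_strict_mono) (use \<open>M > 0\<close> in blast)+
  then obtain k where "F k \<le> (\<Sum>i\<in>UNIV. \<Sum>j\<in>UNIV. w i j * D i j)"
    using not_less by blast
  then show ?thesis using that[of "c k"] near by (simp add: F_def D_def)
qed

section \<open>Almost commuting unitaries\<close>

lemma norm_power2_commutator_cdiag:
  "(norm (cdiag \<mu> ** u - u ** cdiag \<mu>))\<^sup>2
    = (\<Sum>i\<in>UNIV. \<Sum>j\<in>UNIV. (cmod (u $ i $ j))\<^sup>2 * (cmod (\<mu> i - \<mu> j))\<^sup>2)"
proof -
  have "\<mu> i * x - x * \<mu> j = x * (\<mu> i - \<mu> j)" for i j x by (simp add: algebra_simps)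
  then show ?thesis
    unfolding norm_matrix_power2 by (simp add: norm_mult power_mult_distrib)
qed

text \<open>The side \<open>L\<close> stays free: coarse cells move the eigenvalues further, fine
  cells cut away more of \<open>u\<close>.\<close>

lemma exists_commuting_unitaries_of_cdiag:
  fixes u :: "complex^'n^'n"
  assumes u: "unitary_matrix u" and \<mu>: "\<And>i. cmod (\<mu> i) = 1"
    and L: "L > 0" and e: "e > 0"
    and comm: "norm_tr (cdiag \<mu> ** u - u ** cdiag \<mu>) = e"
  obtains a A where "\<And>i. cmod (a i) = 1" "unitary_matrix A" "cdiag a ** A = A ** cdiag a"
    "norm_tr (cdiag \<mu> - cdiag a) \<le> 2 * L"
    "norm_tr (u - A) \<le> 4 * sqrt (e / L) + L"
proof -
  define n where "n = real CARD('n)"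
  have n: "n > 0" by (simp add: n_def)
  define w where "w i j = (cmod (u $ i $ j))\<^sup>2" for i j
  \<comment> \<open>With this many shifts the discretization error 2 / M is at most 2 e / L,
    comparable to the main term.\<close>
  obtain M :: nat where M: "L / e < M" using reals_Archimedean2 by blast
  then have "M > 0" using L e by (metis divide_pos_pos of_nat_0_less_iff order.strict_trans)
  have "1 / M \<le> e / L" using M L e \<open>M > 0\<close> by (simp add: field_simps)
  obtain c :: "'n \<Rightarrow> int \<times> int" where
    near: "\<And>i j. c i = c j \<Longrightarrow> cmod (\<mu> i - \<mu> j) \<le> 2 * L" and
    mass: "(\<Sum>i\<in>UNIV. \<Sum>j\<in>UNIV. if c i = c j then 0 else w i j)
      \<le> (\<Sum>i\<in>UNIV. \<Sum>j\<in>UNIV. w i j * (2 * cmod (\<mu> i - \<mu> j) / L + 2 / M))"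
    using exists_grid_partition[OF L \<open>M > 0\<close>, of w \<mu>] by (auto simp: w_def)
  \<comment> \<open>The representative of a cell is one of its eigenvalues, so it stays on the unit
    circle. The choice depends only on \<open>c i\<close>, so \<open>a\<close> is constant on
    cells.\<close>
  define a where "a i = \<mu> (SOME j. c j = c i)" for i
  have rep: "c (SOME j. c j = c i) = c i" for i by (rule someI) simp
  have a_near: "cmod (\<mu> i - a i) \<le> 2 * L" for i
    unfolding a_def by (rule near) (simp add: rep)
  define S where "S = (\<Sum>i\<in>UNIV. \<Sum>j\<in>UNIV. if a i = a j then 0 else w i j)"
  have W: "(\<Sum>i\<in>UNIV. \<Sum>j\<in>UNIV. w i j) = n"
    using norm_unitary_power2[OF u] by (simp add: norm_matrix_power2 w_def n_def)
  have "norm (cdiag \<mu> ** u - u ** cdiag \<mu>) = e * sqrt n"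
    using comm n unfolding norm_tr_eq by (simp add: n_def field_simps)
  then have E: "(\<Sum>i\<in>UNIV. \<Sum>j\<in>UNIV. w i j * (cmod (\<mu> i - \<mu> j))\<^sup>2) = e\<^sup>2 * n"
    using norm_power2_commutator_cdiag[of \<mu> u] n by (simp add: w_def power_mult_distrib)
  \<comment> \<open>Equal cells give equal values of \<open>a\<close>, so passing from
    \<open>c\<close> to \<open>a\<close> can only remove terms.\<close>
  have "S \<le> (\<Sum>i\<in>UNIV. \<Sum>j\<in>UNIV. if c i = c j then 0 else w i j)"
    unfolding S_def by (intro sum_mono) (auto simp: a_def w_def)
  also note mass
  also have "(\<Sum>i\<in>UNIV. \<Sum>j\<in>UNIV. w i j * (2 * cmod (\<mu> i - \<mu> j) / L + 2 / M))
     \<le> (\<Sum>i\<in>UNIV. \<Sum>j\<in>UNIV. w i j * (cmod (\<mu> i - \<mu> j))\<^sup>2 * (1 / (e * L)) + w i j * (3 * e / L))"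
  proof (intro sum_mono)
    fix i j
    define x where "x = cmod (\<mu> i - \<mu> j)"
    \<comment> \<open>After division by \<open>e * L\<close> this trades the linear cost of
      separation for the squared differences that make up the commutator norm.\<close>
    have "2 * x * e \<le> x\<^sup>2 + e\<^sup>2" by (rule sum_squares_bound)
    then have "2 * x / L \<le> x\<^sup>2 * (1 / (e * L)) + e / L"
      using e L by (simp add: field_simps power2_eq_square)
    then have "2 * x / L + 2 / M \<le> x\<^sup>2 * (1 / (e * L)) + 3 * e / L"
      using mult_left_mono[OF \<open>1 / M \<le> e / L\<close>, of 2] by simp
    then have "w i j * (2 * x / L + 2 / M) \<le> w i j * (x\<^sup>2 * (1 / (e * L)) + 3 * e / L)"
      by (intro mult_left_mono) (simp_all add: w_def)
    then show "w i j * (2 * cmod (\<mu> i - \<mu> j) / L + 2 / M)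
      \<le> w i j * (cmod (\<mu> i - \<mu> j))\<^sup>2 * (1 / (e * L)) + w i j * (3 * e / L)"
      by (simp add: x_def algebra_simps)
  qed
  also have "\<dots> = e\<^sup>2 * n * (1 / (e * L)) + n * (3 * e / L)"
    unfolding sum.distrib sum_distrib_right[symmetric] E W ..
  also have "\<dots> = 4 * (e / L) * n" using e L by (simp add: field_simps power2_eq_square)
  finally have S: "S \<le> 4 * (e / L) * n" .
  \<comment> \<open>The perturbation allowance \<open>L * sqrt n\<close> becomes \<open>L\<close>
    after normalization.\<close>
  obtain A where A: "unitary_matrix A" "cdiag a ** A = A ** cdiag a"
    "norm (A - u) \<le> 2 * sqrt S + L * sqrt n"
    using exists_unitary_commuting_with_cdiag[OF u, of "L * sqrt n" a] L n
    unfolding S_def w_def by auto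
  have "sqrt S \<le> 2 * sqrt (e / L) * sqrt n"
    using real_sqrt_le_mono[OF S] unfolding real_sqrt_mult by simp
  then have "norm (u - A) \<le> (4 * sqrt (e / L) + L) * sqrt n"
    using A(3) by (simp add: norm_minus_commute algebra_simps)
  then have uA: "norm_tr (u - A) \<le> 4 * sqrt (e / L) + L"
    using n by (simp add: norm_tr_eq n_def field_simps)
  have "(norm (cdiag \<mu> - cdiag a))\<^sup>2 = (\<Sum>i\<in>UNIV. (cmod (\<mu> i - a i))\<^sup>2)"
    unfolding norm_matrix_power2
    by (intro sum.cong refl) (simp add: cdiag_def if_distrib[of "\<lambda>x. (cmod x)\<^sup>2"] sum.delta
        if_distrib[of "\<lambda>x. x - _"] cong: if_cong)
  also have "\<dots> \<le> (\<Sum>i\<in>(UNIV :: 'n set). (2 * L)\<^sup>2)"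
    by (intro sum_mono power_mono a_near) auto
  also have "\<dots> = (2 * L * sqrt n)\<^sup>2" using n by (simp add: n_def power_mult_distrib)
  finally have "norm (cdiag \<mu> - cdiag a) \<le> 2 * L * sqrt n"
    by (rule power2_le_imp_le) (use L n in simp)
  then have "norm_tr (cdiag \<mu> - cdiag a) \<le> 2 * L"
    using n by (simp add: norm_tr_eq n_def field_simps)
  moreover have "cmod (a i) = 1" for i by (simp add: a_def \<mu>)
  ultimately show ?thesis using that[of a A] A(1,2) uA by blast
qed

theorem theorem1:
  fixes U\<^sub>1 U\<^sub>2 :: "complex^'n^'n"
  assumes "unitary_matrix U\<^sub>1" and "unitary_matrix U\<^sub>2"
  shows "\<exists>A\<^sub>1 A\<^sub>2 :: complex^'n^'n.
    unitary_matrix A\<^sub>1 \<and> unitary_matrix A\<^sub>2 \<and>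
    commutator A\<^sub>1 A\<^sub>2 = 0 \<and>
    norm_tr (U\<^sub>1 - A\<^sub>1) \<le> 30 * norm_tr (commutator U\<^sub>1 U\<^sub>2) powr (1 / 9) \<and>
    norm_tr (U\<^sub>2 - A\<^sub>2) \<le> 30 * norm_tr (commutator U\<^sub>1 U\<^sub>2) powr (1 / 9) \<and>
    commutator A\<^sub>1 U\<^sub>1 = 0"
proof (cases "commutator U\<^sub>1 U\<^sub>2 = 0")
  case True
  \<comment> \<open>The given matrices already commute; in the other case \<open>e\<close> is
    positive and can set the grid scale.\<close>
  then show ?thesis
    by (intro exI[of _ U\<^sub>1] exI[of _ U\<^sub>2]) (simp add: assms norm_tr_eq commutator_def)
next
  case False
  define e where "e = norm_tr (commutator U\<^sub>1 U\<^sub>2)"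
  have e: "e > 0" using False by (simp add: e_def norm_tr_eq)
  obtain V \<mu> where V: "unitary_matrix V" and \<mu>: "conj_transpose V ** U\<^sub>1 ** V = cdiag \<mu>"
    using normal_unitarily_diagonalizable[of U\<^sub>1] unitary_matrixD[OF assms(1)] by metis
  define u where "u = conj_transpose V ** U\<^sub>2 ** V"
  note V' = unitary_matrix_conj_transpose[OF V]
  have U1: "U\<^sub>1 = V ** cdiag \<mu> ** conj_transpose V"
    by (simp add: \<mu>[symmetric] unitary_conj_cancel V)
  have U2: "U\<^sub>2 = V ** u ** conj_transpose V"
    by (simp add: u_def unitary_conj_cancel V)
  have u: "unitary_matrix u"
    unfolding u_def by (intro unitary_matrix_mult V V' assms)
  have "unitary_matrix (cdiag \<mu>)"
    unfolding \<mu>[symmetric] by (intro unitary_matrix_mult V V' assms)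
  then have \<mu>1: "cmod (\<mu> i) = 1" for i by (simp add: unitary_matrix_cdiag_iff)
  \<comment> \<open>Conjugation by \<open>V\<close> respects norms, differences and commutators, so
    the problem can be solved in the eigenbasis and carried back.\<close>
  have norm_conj: "norm_tr (V ** A ** conj_transpose V) = norm_tr A" for A
    by (simp add: norm_tr_eq norm_mult_unitary V V')
  have diff_conj: "V ** A ** conj_transpose V - V ** B ** conj_transpose V
      = V ** (A - B) ** conj_transpose V" for A B
    by (simp add: matrix_mult_diff_left matrix_mult_diff_right)
  have comm_conj: "commutator (V ** A ** conj_transpose V) (V ** B ** conj_transpose V)
      = V ** (A ** B - B ** A) ** conj_transpose V" for A B
    by (simp add: commutator_def unitary_conj_cancel(3)[OF V] diff_conj)
  have comm: "norm_tr (cdiag \<mu> ** u - u ** cdiag \<mu>) = e"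
    unfolding e_def U1 U2 comm_conj norm_conj ..
  \<comment> \<open>The side used below is L = c^3 = e^(1/3). Then e / L = c^6, so all bounds are
    multiples of c^3.\<close>
  define c where "c = e powr (1 / 9)"
  have c: "c > 0" using e by (simp add: c_def)
  have "c ^ 9 = e" using e by (simp add: c_def powr_realpow[symmetric] powr_powr)
  have "c \<le> 2"
  proof -
    have U: "norm U = sqrt CARD('n)" if "unitary_matrix U" for U :: "complex^'n^'n"
      using norm_unitary_power2[OF that] by (metis norm_ge_zero real_sqrt_unique)
    have "norm (commutator U\<^sub>1 U\<^sub>2) \<le> sqrt CARD('n) + sqrt CARD('n)"
      unfolding commutator_def
      by (rule order_trans[OF norm_triangle_ineq4]) (simp add: U unitary_matrix_mult assms)
    then have "c ^ 9 \<le> 2" unfolding \<open>c ^ 9 = e\<close> e_def norm_tr_eq by (simp add: field_simps)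
    then have "c ^ 9 \<le> 2 ^ 9" by (rule order_trans) simp
    then show ?thesis by (subst (asm) power_mono_iff) (use c in auto)
  qed
  have "e / c ^ 3 = (c ^ 3)\<^sup>2" using c by (simp add: \<open>c ^ 9 = e\<close>[symmetric] field_simps flip: power_add power_mult)
  then have sqrt_e: "sqrt (e / c ^ 3) = c ^ 3" using c by (intro real_sqrt_unique) auto
  \<comment> \<open>The two distances, at most 2 c^3 and 5 c^3, are thus at most 8 c and 20
    c.\<close>
  have "c ^ 3 \<le> 4 * c"
    using mult_mono[OF \<open>c \<le> 2\<close> \<open>c \<le> 2\<close>] c by (simp add: power3_eq_cube)
  obtain a A where a: "\<And>i. cmod (a i) = 1" and A: "unitary_matrix A" "cdiag a ** A = A ** cdiag a"
    and close: "norm_tr (cdiag \<mu> - cdiag a) \<le> 2 * c ^ 3" "norm_tr (u - A) \<le> 4 * sqrt (e / c ^ 3) + c ^ 3"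
    using exists_commuting_unitaries_of_cdiag[OF u \<mu>1 _ e comm, of "c ^ 3"] c by auto
  define A\<^sub>1 where "A\<^sub>1 = V ** cdiag a ** conj_transpose V"
  define A\<^sub>2 where "A\<^sub>2 = V ** A ** conj_transpose V"
  have "unitary_matrix A\<^sub>1" "unitary_matrix A\<^sub>2"
    unfolding A\<^sub>1_def A\<^sub>2_def
    by (intro unitary_matrix_mult V V' A(1) unitary_matrix_cdiag_iff[THEN iffD2] allI a)+
  moreover have "commutator A\<^sub>1 A\<^sub>2 = 0"
    unfolding A\<^sub>1_def A\<^sub>2_def comm_conj by (simp add: A(2))
  moreover have "commutator A\<^sub>1 U\<^sub>1 = 0"
  proof -
    \<comment> \<open>\<open>A\<^sub>1\<close> is diagonal in the same eigenbasis as
      \<open>U\<^sub>1\<close>.\<close>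
    have "cdiag a ** cdiag \<mu> = cdiag \<mu> ** cdiag a"
      by (simp add: vec_eq_iff) (simp add: cdiag_def)
    then show ?thesis unfolding A\<^sub>1_def U1 comm_conj by simp
  qed
  moreover have "norm_tr (U\<^sub>1 - A\<^sub>1) \<le> 30 * c"
    unfolding A\<^sub>1_def U1 diff_conj norm_conj using close(1) \<open>c ^ 3 \<le> 4 * c\<close> c by linarith
  moreover have "norm_tr (U\<^sub>2 - A\<^sub>2) \<le> 30 * c"
    unfolding A\<^sub>2_def U2 diff_conj norm_conj using close(2) sqrt_e \<open>c ^ 3 \<le> 4 * c\<close> c by linarith
  ultimately show ?thesis unfolding c_def e_def by blast
qed

end
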